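(* Let $\mathbb{X}$ be a semi-abelian category and let $(\mathcal{T},\mathcal{F})$ and $(\mathcal{S},\mathcal{G})$ be torsion theories in $\mathbb{X}$ such that $(\mathcal{S},\mathcal{G})\leq(\mathcal{T},\mathcal{F})$. For an object $X$ of $\mathbb{X}$ let $$0\to T(X)\xrightarrow{t_X}X\xrightarrow{f_X}F(X)\to0\quad\text{and}\quad 0\to S(X)\xrightarrow{s_X}X\xrightarrow{g_X}G(X)\to0$$ be the short exact sequences associated with $(\mathcal{T},\mathcal{F})$ and $(\mathcal{S},\mathcal{G})$ respectively. Then the pair $(\mathcal{T},\mathcal{G})$ is a $\mathcal{Z}$-pretorsion theory in $\mathbb{X}$, where $\mathcal{Z}=\mathcal{T}\cap\mathcal{G}$, and for each object $X$ the associated short $\mathcal{Z}$-preexact sequence is $$T(X)\xrightarrow{t_X}X\xrightarrow{g_X}G(X).$$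
   Context: A torsion theory in a semi-abelian category $\mathbb{X}$ is a pair $(\mathcal{T},\mathcal{F})$ of full replete subcategories such that every morphism from an object of $\mathcal{T}$ to an object of $\mathcal{F}$ is zero, and every object $X$ admits a short exact sequence $0\to T(X)\to X\to F(X)\to 0$ with $T(X)\in\mathcal{T}$, $F(X)\in\mathcal{F}$ (the associated short exact sequence, unique up to isomorphism). Order: $(\mathcal{S},\mathcal{G})\leq(\mathcal{T},\mathcal{F})$ iff $\mathcal{S}\subseteq\mathcal{T}$ (equivalently $\mathcal{F}\subseteq\mathcal{G}$). Let $\mathcal{Z}$ be a class of objects of $\mathbb{X}$. A morphism is $\mathcal{Z}$-trivial if it factors through an object of $\mathcal{Z}$. A morphism $k:K\to A$ is a $\mathcal{Z}$-prekernel of $f:A\to B$ if $fk$ is $\mathcal{Z}$-trivial and for every $x:X\to A$ with $fx$ $\mathcal{Z}$-trivial there is a unique $\lambda:X\to K$ with $k\lambda=x$. $\mathcal{Z}$-precokernels are defined dually. A sequence $A\xrightarrow{f}B\xrightarrow{g}C$ is short $\mathcal{Z}$-preexact if $f$ is a $\mathcal{Z}$-prekernel of $g$ and $g$ is a $\mathcal{Z}$-precokernel of $f$. A pair $(\mathbb{T},\mathbb{F})$ of full subcategories is a $\mathcal{Z}$-pretorsion theory, with $\mathcal{Z}=\mathbb{T}\cap\mathbb{F}$, if every morphism from an object of $\mathbb{T}$ to an object of $\mathbb{F}$ is $\mathcal{Z}$-trivial, and for every object $X$ there is a short $\mathcal{Z}$-preexact sequence $T_X\to X\to F_X$ with $T_X\in\mathbb{T}$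 and $F_X\in\mathbb{F}$. *)

theory Defs
  imports Main
begin

section \<open>Categories\<close>

record ('o, 'm) cat =
  objs :: "'o set"
  arrs :: "'m set"
  source :: "'m \<Rightarrow> 'o"
  target :: "'m \<Rightarrow> 'o"
  ident :: "'o \<Rightarrow> 'm"
  compose :: "'m \<Rightarrow> 'm \<Rightarrow> 'm"  (infixr "\<cdot>\<index>" 70)

text \<open>Composition is written in the usual order: \<open>g \<cdot>\<^bsub>C\<^esub> f\<close> is \<open>f\<close> followed by \<open>g\<close>.
  It is unspecified on pairs that are not composable.\<close>

definition hom :: "('o, 'm, 'z) cat_scheme \<Rightarrow> 'o \<Rightarrow> 'o \<Rightarrow> 'm set" where
  "hom C A B = {f \<in> arrs C. source C f = A \<and> target C f = B}"

locale category =
  fixes C :: "('o, 'm, 'z) cat_scheme" (structure)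
  assumes source_in_objs: "f \<in> arrs C \<Longrightarrow> source C f \<in> objs C"
    and target_in_objs: "f \<in> arrs C \<Longrightarrow> target C f \<in> objs C"
    and ident_in_hom: "A \<in> objs C \<Longrightarrow> ident C A \<in> hom C A A"
    and compose_in_hom: "f \<in> hom C A B \<Longrightarrow> g \<in> hom C B D \<Longrightarrow> g \<cdot> f \<in> hom C A D"
    and compose_assoc:
      "f \<in> hom C A B \<Longrightarrow> g \<in> hom C B D \<Longrightarrow> h \<in> hom C D E \<Longrightarrow> (h \<cdot> g) \<cdot> f = h \<cdot> (g \<cdot> f)"
    and compose_ident_left: "f \<in> hom C A B \<Longrightarrow> ident C B \<cdot> f = f"
    and compose_ident_right: "f \<in> hom C A B \<Longrightarrow> f \<cdot> ident C A = f"

definition is_iso :: "('o, 'm, 'z) cat_scheme \<Rightarrow> 'm \<Rightarrow> bool" where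
  "is_iso C f \<longleftrightarrow> f \<in> arrs C \<and>
     (\<exists>g \<in> hom C (target C f) (source C f).
        g \<cdot>\<^bsub>C\<^esub> f = ident C (source C f) \<and> f \<cdot>\<^bsub>C\<^esub> g = ident C (target C f))"

definition isomorphic :: "('o, 'm, 'z) cat_scheme \<Rightarrow> 'o \<Rightarrow> 'o \<Rightarrow> bool" where
  "isomorphic C A B \<longleftrightarrow> (\<exists>f \<in> hom C A B. is_iso C f)"

definition zero_object :: "('o, 'm, 'z) cat_scheme \<Rightarrow> 'o \<Rightarrow> bool" where
  "zero_object C Z \<longleftrightarrow> Z \<in> objs C \<and>
     (\<forall>A \<in> objs C. (\<exists>!f. f \<in> hom C A Z) \<and> (\<exists>!f. f \<in> hom C Z A))"

definition terminal_object :: "('o, 'm, 'z) cat_scheme \<Rightarrow> 'o \<Rightarrow> bool" where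
  "terminal_object C Z \<longleftrightarrow> Z \<in> objs C \<and> (\<forall>A \<in> objs C. \<exists>!f. f \<in> hom C A Z)"

text \<open>In \<open>is_pullback C f g p q\<close>, the cospan is \<open>(f, g)\<close> and the limiting span is \<open>(p, q)\<close>,
  with \<open>p\<close> opposite to \<open>g\<close> and \<open>q\<close> opposite to \<open>f\<close>, so that \<open>f p = g q\<close>.\<close>

definition is_pullback :: "('o, 'm, 'z) cat_scheme \<Rightarrow> 'm \<Rightarrow> 'm \<Rightarrow> 'm \<Rightarrow> 'm \<Rightarrow> bool" where
  "is_pullback C f g p q \<longleftrightarrow>
     f \<in> arrs C \<and> g \<in> arrs C \<and> p \<in> arrs C \<and> q \<in> arrs C \<and>
     target C f = target C g \<and> target C p = source C f \<and> target C q = source C g \<and>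
     source C p = source C q \<and> f \<cdot>\<^bsub>C\<^esub> p = g \<cdot>\<^bsub>C\<^esub> q \<and>
     (\<forall>X \<in> objs C. \<forall>x \<in> hom C X (source C f). \<forall>y \<in> hom C X (source C g).
        f \<cdot>\<^bsub>C\<^esub> x = g \<cdot>\<^bsub>C\<^esub> y \<longrightarrow>
        (\<exists>!u. u \<in> hom C X (source C p) \<and> p \<cdot>\<^bsub>C\<^esub> u = x \<and> q \<cdot>\<^bsub>C\<^esub> u = y))"

definition is_coproduct ::
    "('o, 'm, 'z) cat_scheme \<Rightarrow> 'o \<Rightarrow> 'o \<Rightarrow> 'o \<Rightarrow> 'm \<Rightarrow> 'm \<Rightarrow> bool" where
  "is_coproduct C A B Q i j \<longleftrightarrow> i \<in> hom C A Q \<and> j \<in> hom C B Q \<and>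
     (\<forall>X \<in> objs C. \<forall>x \<in> hom C A X. \<forall>y \<in> hom C B X.
        \<exists>!u. u \<in> hom C Q X \<and> u \<cdot>\<^bsub>C\<^esub> i = x \<and> u \<cdot>\<^bsub>C\<^esub> j = y)"

definition is_coequalizer :: "('o, 'm, 'z) cat_scheme \<Rightarrow> 'm \<Rightarrow> 'm \<Rightarrow> 'm \<Rightarrow> bool" where
  "is_coequalizer C r s q \<longleftrightarrow>
     r \<in> arrs C \<and> s \<in> arrs C \<and> q \<in> arrs C \<and>
     source C r = source C s \<and> target C r = target C s \<and> source C q = target C r \<and>
     q \<cdot>\<^bsub>C\<^esub> r = q \<cdot>\<^bsub>C\<^esub> s \<and>
     (\<forall>X \<in> objs C. \<forall>x \<in> hom C (target C r) X. x \<cdot>\<^bsub>C\<^esub> r = x \<cdot>\<^bsub>C\<^esub> s \<longrightarrow>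
        (\<exists>!u. u \<in> hom C (target C q) X \<and> u \<cdot>\<^bsub>C\<^esub> q = x))"

definition regular_epi :: "('o, 'm, 'z) cat_scheme \<Rightarrow> 'm \<Rightarrow> bool" where
  "regular_epi C q \<longleftrightarrow> (\<exists>r s. is_coequalizer C r s q)"


section \<open>Semi-abelian categories\<close>

text \<open>In the sense of Janelidze, Marki and Tholen: pointed, Barr exact, Bourn protomodular,
  with binary coproducts.\<close>

definition pointed :: "('o, 'm, 'z) cat_scheme \<Rightarrow> bool" where
  "pointed C \<longleftrightarrow> (\<exists>Z. zero_object C Z)"

definition has_binary_coproducts :: "('o, 'm, 'z) cat_scheme \<Rightarrow> bool" where
  "has_binary_coproducts C \<longleftrightarrow>
     (\<forall>A \<in> objs C. \<forall>B \<in> objs C. \<exists>Q i j. is_coproduct C A B Q i j)"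

text \<open>Finite limits are generated by a terminal object and pullbacks.\<close>

definition finitely_complete :: "('o, 'm, 'z) cat_scheme \<Rightarrow> bool" where
  "finitely_complete C \<longleftrightarrow> (\<exists>Z. terminal_object C Z) \<and>
     (\<forall>f \<in> arrs C. \<forall>g \<in> arrs C. target C f = target C g \<longrightarrow> (\<exists>p q. is_pullback C f g p q))"

text \<open>Besides finite limits: every kernel pair has a coequalizer, and regular epimorphisms
  are stable under pullback.\<close>

definition regular_category :: "('o, 'm, 'z) cat_scheme \<Rightarrow> bool" where
  "regular_category C \<longleftrightarrow> finitely_complete C \<and>
     (\<forall>f r s. is_pullback C f f r s \<longrightarrow> (\<exists>q. is_coequalizer C r s q)) \<and>
     (\<forall>f g p q. is_pullback C f g p q \<and> regular_epi C g \<longrightarrow> regular_epi C p)"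

text \<open>A pair \<open>(r, s) : R \<rightarrow> A\<close> is an internal equivalence relation (Barr) if, for every object
  \<open>X\<close>, the map \<open>hom X R \<rightarrow> hom X A \<times> hom X A\<close> it induces is injective with image an equivalence
  relation on the set \<open>hom X A\<close>.\<close>

definition equivalence_relation :: "('o, 'm, 'z) cat_scheme \<Rightarrow> 'm \<Rightarrow> 'm \<Rightarrow> bool" where
  "equivalence_relation C r s \<longleftrightarrow>
     r \<in> arrs C \<and> s \<in> arrs C \<and> source C r = source C s \<and> target C r = target C s \<and>
     (\<forall>X \<in> objs C.
        inj_on (\<lambda>u. (r \<cdot>\<^bsub>C\<^esub> u, s \<cdot>\<^bsub>C\<^esub> u)) (hom C X (source C r)) \<and>
        equiv (hom C X (target C r)) ((\<lambda>u. (r \<cdot>\<^bsub>C\<^esub> u, s \<cdot>\<^bsub>C\<^esub> u)) ` hom C X (source C r)))"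

definition barr_exact :: "('o, 'm, 'z) cat_scheme \<Rightarrow> bool" where
  "barr_exact C \<longleftrightarrow> regular_category C \<and>
     (\<forall>r s. equivalence_relation C r s \<longrightarrow> (\<exists>f. is_pullback C f f r s))"

text \<open>\<open>(p, s)\<close> is an object of the category of points over \<open>B\<close>, with underlying object \<open>E\<close>.\<close>

definition is_point :: "('o, 'm, 'z) cat_scheme \<Rightarrow> 'o \<Rightarrow> 'o \<Rightarrow> 'm \<Rightarrow> 'm \<Rightarrow> bool" where
  "is_point C B E p s \<longleftrightarrow> p \<in> hom C E B \<and> s \<in> hom C B E \<and> p \<cdot>\<^bsub>C\<^esub> s = ident C B"

text \<open>Bourn's condition: for every \<open>v : A \<rightarrow> B\<close> the change-of-base functor from points over \<open>B\<close>
  to points over \<open>A\<close> reflects isomorphisms.  Below, \<open>h\<close> is a morphism of points over \<open>B\<close> from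
  \<open>(p, s)\<close> to \<open>(p', s')\<close>, the points are pulled back along \<open>v\<close>, and \<open>k\<close> is the value of the
  functor at \<open>h\<close>; it is determined by the two equations given for it, and its
  compatibility with the induced sections is automatic.\<close>

definition protomodular :: "('o, 'm, 'z) cat_scheme \<Rightarrow> bool" where
  "protomodular C \<longleftrightarrow>
     (\<forall>A B v E p s E' p' s' h P a e P' a' e' k.
        v \<in> hom C A B \<and>
        is_point C B E p s \<and> is_point C B E' p' s' \<and>
        h \<in> hom C E E' \<and> p' \<cdot>\<^bsub>C\<^esub> h = p \<and> h \<cdot>\<^bsub>C\<^esub> s = s' \<and>
        a \<in> hom C P A \<and> e \<in> hom C P E \<and> is_pullback C v p a e \<and>
        a' \<in> hom C P' A \<and> e' \<in> hom C P' E' \<and> is_pullback C v p' a' e' \<and>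
        k \<in> hom C P P' \<and> a' \<cdot>\<^bsub>C\<^esub> k = a \<and> e' \<cdot>\<^bsub>C\<^esub> k = h \<cdot>\<^bsub>C\<^esub> e \<and>
        is_iso C k
        \<longrightarrow> is_iso C h)"

definition semi_abelian :: "('o, 'm, 'z) cat_scheme \<Rightarrow> bool" where
  "semi_abelian C \<longleftrightarrow> category C \<and> pointed C \<and> has_binary_coproducts C \<and>
     barr_exact C \<and> protomodular C"


section \<open>Trivial morphisms and preexact sequences\<close>

definition trivial_arr :: "('o, 'm, 'z) cat_scheme \<Rightarrow> 'o set \<Rightarrow> 'm \<Rightarrow> bool" where
  "trivial_arr C \<Z> f \<longleftrightarrow> f \<in> arrs C \<and>
     (\<exists>Z \<in> \<Z>. \<exists>g \<in> hom C (source C f) Z. \<exists>h \<in> hom C Z (target C f). f = h \<cdot>\<^bsub>C\<^esub> g)"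

definition is_prekernel :: "('o, 'm, 'z) cat_scheme \<Rightarrow> 'o set \<Rightarrow> 'm \<Rightarrow> 'm \<Rightarrow> bool" where
  "is_prekernel C \<Z> f k \<longleftrightarrow>
     f \<in> arrs C \<and> k \<in> arrs C \<and> target C k = source C f \<and> trivial_arr C \<Z> (f \<cdot>\<^bsub>C\<^esub> k) \<and>
     (\<forall>X \<in> objs C. \<forall>x \<in> hom C X (source C f). trivial_arr C \<Z> (f \<cdot>\<^bsub>C\<^esub> x) \<longrightarrow>
        (\<exists>!l. l \<in> hom C X (source C k) \<and> k \<cdot>\<^bsub>C\<^esub> l = x))"

definition is_precokernel :: "('o, 'm, 'z) cat_scheme \<Rightarrow> 'o set \<Rightarrow> 'm \<Rightarrow> 'm \<Rightarrow> bool" where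
  "is_precokernel C \<Z> f c \<longleftrightarrow>
     f \<in> arrs C \<and> c \<in> arrs C \<and> source C c = target C f \<and> trivial_arr C \<Z> (c \<cdot>\<^bsub>C\<^esub> f) \<and>
     (\<forall>X \<in> objs C. \<forall>x \<in> hom C (target C f) X. trivial_arr C \<Z> (x \<cdot>\<^bsub>C\<^esub> f) \<longrightarrow>
        (\<exists>!l. l \<in> hom C (target C c) X \<and> l \<cdot>\<^bsub>C\<^esub> c = x))"

definition short_preexact :: "('o, 'm, 'z) cat_scheme \<Rightarrow> 'o set \<Rightarrow> 'm \<Rightarrow> 'm \<Rightarrow> bool" where
  "short_preexact C \<Z> f g \<longleftrightarrow> is_prekernel C \<Z> g f \<and> is_precokernel C \<Z> f g"

text \<open>Zero morphisms, kernels, cokernels and short exact sequences in a pointed category are the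
  instances of the above where the class consists of the zero objects.\<close>

abbreviation zero_objs :: "('o, 'm, 'z) cat_scheme \<Rightarrow> 'o set" where
  "zero_objs C \<equiv> {Z. zero_object C Z}"

definition zero_arr :: "('o, 'm, 'z) cat_scheme \<Rightarrow> 'm \<Rightarrow> bool" where
  "zero_arr C f \<longleftrightarrow> trivial_arr C (zero_objs C) f"

definition short_exact :: "('o, 'm, 'z) cat_scheme \<Rightarrow> 'm \<Rightarrow> 'm \<Rightarrow> bool" where
  "short_exact C f g \<longleftrightarrow> short_preexact C (zero_objs C) f g"


section \<open>Torsion and pretorsion theories\<close>

text \<open>A full subcategory is given by its set of objects.\<close>

definition full_subcategory :: "('o, 'm, 'z) cat_scheme \<Rightarrow> 'o set \<Rightarrow> bool" where
  "full_subcategory C \<T> \<longleftrightarrow> \<T> \<subseteq> objs C"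

definition replete :: "('o, 'm, 'z) cat_scheme \<Rightarrow> 'o set \<Rightarrow> bool" where
  "replete C \<T> \<longleftrightarrow> (\<forall>A \<in> \<T>. \<forall>B \<in> objs C. isomorphic C A B \<longrightarrow> B \<in> \<T>)"

text \<open>\<open>torsion_sequence C \<T> \<F> X A t f B\<close>: the sequence \<open>0 \<rightarrow> A \<rightarrow> X \<rightarrow> B \<rightarrow> 0\<close> with maps
  \<open>t\<close> and \<open>f\<close> is a short exact sequence associated with \<open>X\<close>.  Such a sequence is unique up
  to isomorphism; no choice is made.\<close>

definition torsion_sequence ::
    "('o, 'm, 'z) cat_scheme \<Rightarrow> 'o set \<Rightarrow> 'o set \<Rightarrow> 'o \<Rightarrow> 'o \<Rightarrow> 'm \<Rightarrow> 'm \<Rightarrow> 'o \<Rightarrow> bool" where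
  "torsion_sequence C \<T> \<F> X A t f B \<longleftrightarrow>
     A \<in> \<T> \<and> B \<in> \<F> \<and> t \<in> hom C A X \<and> f \<in> hom C X B \<and> short_exact C t f"

definition torsion_theory :: "('o, 'm, 'z) cat_scheme \<Rightarrow> 'o set \<Rightarrow> 'o set \<Rightarrow> bool" where
  "torsion_theory C \<T> \<F> \<longleftrightarrow>
     full_subcategory C \<T> \<and> replete C \<T> \<and> full_subcategory C \<F> \<and> replete C \<F> \<and>
     (\<forall>A \<in> \<T>. \<forall>B \<in> \<F>. \<forall>f \<in> hom C A B. zero_arr C f) \<and>
     (\<forall>X \<in> objs C. \<exists>A t f B. torsion_sequence C \<T> \<F> X A t f B)"

definition pretorsion_sequence ::
    "('o, 'm, 'z) cat_scheme \<Rightarrow> 'o set \<Rightarrow> 'o set \<Rightarrow> 'o set \<Rightarrow> 'o \<Rightarrow> 'o \<Rightarrow> 'm \<Rightarrow> 'm \<Rightarrow> 'o \<Rightarrow> bool"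
  where
  "pretorsion_sequence C \<Z> \<T> \<F> X A t f B \<longleftrightarrow>
     A \<in> \<T> \<and> B \<in> \<F> \<and> t \<in> hom C A X \<and> f \<in> hom C X B \<and> short_preexact C \<Z> t f"

definition pretorsion_theory ::
    "('o, 'm, 'z) cat_scheme \<Rightarrow> 'o set \<Rightarrow> 'o set \<Rightarrow> 'o set \<Rightarrow> bool" where
  "pretorsion_theory C \<Z> \<T> \<F> \<longleftrightarrow>
     full_subcategory C \<T> \<and> full_subcategory C \<F> \<and> \<Z> = \<T> \<inter> \<F> \<and>
     (\<forall>A \<in> \<T>. \<forall>B \<in> \<F>. \<forall>f \<in> hom C A B. trivial_arr C \<Z> f) \<and>
     (\<forall>X \<in> objs C. \<exists>A t f B. pretorsion_sequence C \<Z> \<T> \<F> X A t f B)"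

end

theory Submission
  imports Defs
begin

text \<open>
  Everything rests on factorizations through kernels and cokernels.  Write \<open>0 \<rightarrow> TX \<rightarrow> X \<rightarrow> FX \<rightarrow> 0\<close> (maps \<open>t\<close>, \<open>f\<close>) and
  \<open>0 \<rightarrow> SX \<rightarrow> X \<rightarrow> GX \<rightarrow> 0\<close> (maps \<open>s\<close>, \<open>g\<close>) for the two exact sequences of \<open>X\<close>.

  A morphism \<open>A \<rightarrow> B\<close> with \<open>A \<in> \<T>\<close> and \<open>B \<in> \<G>\<close> kills \<open>SA\<close>, so it factors through the cokernel
  \<open>GA\<close>.  This object lies in \<open>\<G>\<close>, and also in \<open>\<T>\<close>, because it is a quotient of \<open>A\<close> and a
  torsion class is closed under quotients (\<open>torsion_quotient\<close>).  Hence the morphism is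
  \<open>\<T> \<inter> \<G>\<close>-trivial (\<open>torsion_to_torsion_free_trivial\<close>); in particular \<open>g t\<close> is.

  Since \<open>SX \<in> \<S> \<subseteq> \<T>\<close>, the composite \<open>f s : SX \<rightarrow> FX\<close> vanishes.  As \<open>t\<close> is a kernel and \<open>g\<close> a
  cokernel, this one equation yields both \<open>s = t i\<close> and \<open>f = p g\<close> for some
  \<open>i : SX \<rightarrow> TX\<close> and \<open>p : GX \<rightarrow> FX\<close>.  If \<open>g x\<close> factors through \<open>Z \<in> \<T> \<inter> \<G>\<close>, then \<open>f x = p g x\<close>
  factors through a morphism \<open>Z \<rightarrow> FX\<close> from \<open>\<T>\<close> to \<open>\<F>\<close>, so it vanishes and \<open>x\<close> factors uniquely
  through the kernel \<open>t\<close> (\<open>torsion_part_prekernel\<close>).  Dually, if \<open>y t\<close> factors through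
  \<open>Z \<in> \<T> \<inter> \<G>\<close>, then \<open>y s = y t i\<close> factors through a morphism \<open>SX \<rightarrow> Z\<close> from \<open>\<S>\<close> to \<open>\<G>\<close>, so it
  vanishes and \<open>y\<close> factors uniquely through the cokernel \<open>g\<close> (\<open>torsion_free_part_precokernel\<close>).
\<close>

section \<open>Trivial morphisms, prekernels and precokernels\<close>

lemma hom_source: "f \<in> hom C A B \<Longrightarrow> source C f = A"
  and hom_target: "f \<in> hom C A B \<Longrightarrow> target C f = B"
  and hom_arr: "f \<in> hom C A B \<Longrightarrow> f \<in> arrs C"
  by (auto simp: hom_def)

lemma trivial_arr_hom:
  assumes "f \<in> hom C A B"
  shows "trivial_arr C \<Z> f \<longleftrightarrow> (\<exists>Z \<in> \<Z>. \<exists>g \<in> hom C A Z. \<exists>h \<in> hom C Z B. f = h \<cdot>\<^bsub>C\<^esub> g)"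
  using assms by (auto simp: trivial_arr_def hom_def)

lemma is_prekernel_hom:
  assumes "f \<in> hom C A B" and "k \<in> hom C K A"
  shows "is_prekernel C \<Z> f k \<longleftrightarrow> trivial_arr C \<Z> (f \<cdot>\<^bsub>C\<^esub> k) \<and>
     (\<forall>X \<in> objs C. \<forall>x \<in> hom C X A. trivial_arr C \<Z> (f \<cdot>\<^bsub>C\<^esub> x) \<longrightarrow>
        (\<exists>!l. l \<in> hom C X K \<and> k \<cdot>\<^bsub>C\<^esub> l = x))"
  using assms by (auto simp: is_prekernel_def hom_source hom_target hom_arr)

lemma is_precokernel_hom:
  assumes "f \<in> hom C A B" and "c \<in> hom C B Q"
  shows "is_precokernel C \<Z> f c \<longleftrightarrow> trivial_arr C \<Z> (c \<cdot>\<^bsub>C\<^esub> f) \<and>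
     (\<forall>X \<in> objs C. \<forall>x \<in> hom C B X. trivial_arr C \<Z> (x \<cdot>\<^bsub>C\<^esub> f) \<longrightarrow>
        (\<exists>!l. l \<in> hom C Q X \<and> l \<cdot>\<^bsub>C\<^esub> c = x))"
  using assms by (auto simp: is_precokernel_def hom_source hom_target hom_arr)

lemma torsion_theory_zero:
  assumes "torsion_theory C \<T> \<F>" and "A \<in> \<T>" and "B \<in> \<F>" and "f \<in> hom C A B"
  shows "trivial_arr C (zero_objs C) f"
  using assms unfolding torsion_theory_def zero_arr_def by blast

context category
begin

lemma hom_objs:
  assumes "f \<in> hom C A B"
  shows "A \<in> objs C" and "B \<in> objs C"
  using assms source_in_objs target_in_objs by (auto simp: hom_def)

lemma trivial_arr_compose_right:
  assumes "f \<in> hom C A B" and "g \<in> hom C B D" and "trivial_arr C \<Z> g"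
  shows "trivial_arr C \<Z> (g \<cdot> f)"
proof -
  obtain Z u v where "Z \<in> \<Z>" and u: "u \<in> hom C B Z" and v: "v \<in> hom C Z D" and "g = v \<cdot> u"
    using assms by (auto simp: trivial_arr_hom)
  then have "g \<cdot> f = v \<cdot> (u \<cdot> f)"
    using assms compose_assoc by simp
  then show ?thesis
    using \<open>Z \<in> \<Z>\<close> v compose_in_hom[OF assms(1) u] trivial_arr_hom[OF compose_in_hom[OF assms(1,2)]]
    by blast
qed

lemma trivial_arr_compose_left:
  assumes "f \<in> hom C A B" and "g \<in> hom C B D" and "trivial_arr C \<Z> f"
  shows "trivial_arr C \<Z> (g \<cdot> f)"
proof -
  obtain Z u v where "Z \<in> \<Z>" and u: "u \<in> hom C A Z" and v: "v \<in> hom C Z B" and "f = v \<cdot> u"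
    using assms by (auto simp: trivial_arr_hom)
  then have "g \<cdot> f = (g \<cdot> v) \<cdot> u"
    using assms compose_assoc by simp
  then show ?thesis
    using \<open>Z \<in> \<Z>\<close> u compose_in_hom[OF v assms(2)] trivial_arr_hom[OF compose_in_hom[OF assms(1,2)]]
    by blast
qed

text \<open>Trivial morphisms form an ideal, so \<open>f (k a)\<close> is trivial for every \<open>a\<close>; hence \<open>k a\<close> factors
  through \<open>k\<close> in only one way.\<close>

lemma prekernel_mono:
  assumes "is_prekernel C \<Z> f k" and f: "f \<in> hom C A B" and k: "k \<in> hom C K A"
    and a: "a \<in> hom C X K" and b: "b \<in> hom C X K" and eq: "k \<cdot> a = k \<cdot> b"
  shows "a = b"
proof -
  have "trivial_arr C \<Z> (f \<cdot> k)"
    using assms(1) is_prekernel_hom[OF f k] by blast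
  then have "trivial_arr C \<Z> (f \<cdot> (k \<cdot> a))"
    using trivial_arr_compose_right[OF a compose_in_hom[OF k f]] compose_assoc[OF a k f] by simp
  then have "\<exists>!l. l \<in> hom C X K \<and> k \<cdot> l = k \<cdot> a"
    using assms(1) is_prekernel_hom[OF f k] compose_in_hom[OF a k] hom_objs(1)[OF a] by blast
  then show ?thesis
    using a b eq by auto
qed

lemma precokernel_epi:
  assumes "is_precokernel C \<Z> f c" and f: "f \<in> hom C A B" and c: "c \<in> hom C B Q"
    and a: "a \<in> hom C Q X" and b: "b \<in> hom C Q X" and eq: "a \<cdot> c = b \<cdot> c"
  shows "a = b"
proof -
  have "trivial_arr C \<Z> (c \<cdot> f)"
    using assms(1) is_precokernel_hom[OF f c] by blast
  then have "trivial_arr C \<Z> ((a \<cdot> c) \<cdot> f)"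
    using trivial_arr_compose_left[OF compose_in_hom[OF f c] a] compose_assoc[OF f c a] by simp
  then have "\<exists>!l. l \<in> hom C Q X \<and> l \<cdot> c = a \<cdot> c"
    using assms(1) is_precokernel_hom[OF f c] compose_in_hom[OF c a] hom_objs(2)[OF a] by blast
  then show ?thesis
    using a b eq by auto
qed

lemma prekernel_of_trivial_iso:
  assumes "is_prekernel C \<Z> f k" and f: "f \<in> hom C A B" and k: "k \<in> hom C K A"
    and "trivial_arr C \<Z> f"
  shows "is_iso C k"
proof -
  have id: "ident C A \<in> hom C A A"
    using ident_in_hom hom_objs[OF f] by blast
  have "trivial_arr C \<Z> (f \<cdot> ident C A)"
    using assms(4) compose_ident_right[OF f] by simp
  then obtain l where l: "l \<in> hom C A K" and kl: "k \<cdot> l = ident C A"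
    using assms(1) is_prekernel_hom[OF f k] id hom_objs[OF f] by blast
  have idK: "ident C K \<in> hom C K K"
    using ident_in_hom hom_objs[OF k] by blast
  have "k \<cdot> (l \<cdot> k) = k \<cdot> ident C K"
    using compose_assoc[OF k l k] kl compose_ident_left[OF k] compose_ident_right[OF k] by simp
  then have "l \<cdot> k = ident C K"
    using prekernel_mono[OF assms(1) f k compose_in_hom[OF k l] idK] by blast
  then show ?thesis
    using l kl k by (auto simp: is_iso_def hom_source hom_target hom_arr)
qed

text \<open>A zero morphism out of \<open>A\<close> factors through any given \<open>e : A \<rightarrow> B\<close>, because \<open>A \<rightarrow> 0\<close> equals
  \<open>A \<rightarrow> B \<rightarrow> 0\<close>.  So \<open>f e = 0 e\<close> for the zero morphism \<open>0 : B \<rightarrow> D\<close>, and \<open>e\<close> can be cancelled.\<close>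

lemma zero_arr_cancel_epi:
  assumes e: "e \<in> hom C A B" and f: "f \<in> hom C B D"
    and epi: "\<And>a b. a \<in> hom C B D \<Longrightarrow> b \<in> hom C B D \<Longrightarrow> a \<cdot> e = b \<cdot> e \<Longrightarrow> a = b"
    and "trivial_arr C (zero_objs C) (f \<cdot> e)"
  shows "trivial_arr C (zero_objs C) f"
proof -
  obtain Z u v where Z: "zero_object C Z" and u: "u \<in> hom C A Z" and v: "v \<in> hom C Z D"
    and fe: "f \<cdot> e = v \<cdot> u"
    using assms(4) trivial_arr_hom[OF compose_in_hom[OF e f]] by auto
  obtain w where w: "w \<in> hom C B Z"
    using Z hom_objs(1)[OF f] unfolding zero_object_def by blast
  have "w \<cdot> e = u"
    using Z hom_objs(1)[OF e] u compose_in_hom[OF e w] unfolding zero_object_def by blast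
  then have "f \<cdot> e = (v \<cdot> w) \<cdot> e"
    using fe compose_assoc[OF e w v] by simp
  then have "f = v \<cdot> w"
    using epi f compose_in_hom[OF w v] by blast
  then show ?thesis
    using Z w v trivial_arr_hom[OF f] by blast
qed

section \<open>Torsion theories\<close>

text \<open>A quotient \<open>e : A \<rightarrow> B\<close> of a torsion object is torsion: the composite \<open>A \<rightarrow> B \<rightarrow> F(B)\<close> is
  zero, so \<open>B \<rightarrow> F(B)\<close> is zero and its kernel \<open>T(B) \<rightarrow> B\<close> is an isomorphism.\<close>

lemma torsion_quotient:
  assumes tt: "torsion_theory C \<T> \<F>" and "A \<in> \<T>" and e: "e \<in> hom C A B"
    and epi: "\<And>D a b. a \<in> hom C B D \<Longrightarrow> b \<in> hom C B D \<Longrightarrow> a \<cdot> e = b \<cdot> e \<Longrightarrow> a = b"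
  shows "B \<in> \<T>"
proof -
  have B: "B \<in> objs C"
    using hom_objs(2)[OF e] .
  then obtain TB t f FB where "torsion_sequence C \<T> \<F> B TB t f FB"
    using tt unfolding torsion_theory_def by blast
  then have TB: "TB \<in> \<T>" and FB: "FB \<in> \<F>" and t: "t \<in> hom C TB B" and f: "f \<in> hom C B FB"
    and ker: "is_prekernel C (zero_objs C) f t"
    unfolding torsion_sequence_def short_exact_def short_preexact_def by auto
  have "trivial_arr C (zero_objs C) (f \<cdot> e)"
    using torsion_theory_zero[OF tt \<open>A \<in> \<T>\<close> FB] compose_in_hom[OF e f] by blast
  then have "trivial_arr C (zero_objs C) f"
    by (rule zero_arr_cancel_epi[OF e f, rotated]) (rule epi)
  then have "isomorphic C TB B"
    using prekernel_of_trivial_iso[OF ker f t] t unfolding isomorphic_def by blast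
  then show ?thesis
    using tt TB B unfolding torsion_theory_def replete_def by blast
qed

text \<open>The intermediate object is the quotient \<open>G(A)\<close> of the source: \<open>f\<close> vanishes on \<open>S(A)\<close> since its
  target is in \<open>\<G>\<close>, and \<open>G(A)\<close> inherits membership in \<open>\<T>\<close> from \<open>A\<close>.\<close>

lemma torsion_to_torsion_free_trivial:
  assumes tt: "torsion_theory C \<T> \<F>" and ss: "torsion_theory C \<S> \<G>"
    and A: "A \<in> \<T>" and B: "B \<in> \<G>" and f: "f \<in> hom C A B"
  shows "trivial_arr C (\<T> \<inter> \<G>) f"
proof -
  obtain SA s g GA where "torsion_sequence C \<S> \<G> A SA s g GA"
    using ss hom_objs(1)[OF f] unfolding torsion_theory_def by blast
  then have SA: "SA \<in> \<S>" and GA: "GA \<in> \<G>" and s: "s \<in> hom C SA A" and g: "g \<in> hom C A GA"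
    and coker: "is_precokernel C (zero_objs C) s g"
    unfolding torsion_sequence_def short_exact_def short_preexact_def by auto
  have "GA \<in> \<T>"
    by (rule torsion_quotient[OF tt A g]) (rule precokernel_epi[OF coker s g])
  have "trivial_arr C (zero_objs C) (f \<cdot> s)"
    using torsion_theory_zero[OF ss SA B compose_in_hom[OF s f]] .
  then obtain l where "l \<in> hom C GA B" and "l \<cdot> g = f"
    using coker is_precokernel_hom[OF s g] f hom_objs(2)[OF f] by blast
  then show ?thesis
    using trivial_arr_hom[OF f] \<open>GA \<in> \<T>\<close> GA g by blast
qed

section \<open>The pretorsion theory of a comparable pair of torsion theories\<close>

text \<open>The object through which \<open>g x\<close> factors is torsion, and \<open>f\<close> factors through \<open>g\<close>; so whenever
  \<open>g x\<close> is trivial, \<open>f x\<close> factors through a morphism from \<open>\<T>\<close> to \<open>\<F>\<close> and is zero.\<close>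

lemma torsion_part_prekernel:
  assumes tt: "torsion_theory C \<T> \<F>" and ss: "torsion_theory C \<S> \<G>" and "\<S> \<subseteq> \<T>"
    and tX: "torsion_sequence C \<T> \<F> X TX t f FX"
    and sX: "torsion_sequence C \<S> \<G> X SX s g GX"
  shows "is_prekernel C (\<T> \<inter> \<G>) g t"
proof -
  have TX: "TX \<in> \<T>" and FX: "FX \<in> \<F>" and t: "t \<in> hom C TX X" and f: "f \<in> hom C X FX"
    and ker: "is_prekernel C (zero_objs C) f t"
    using tX unfolding torsion_sequence_def short_exact_def short_preexact_def by auto
  have SX: "SX \<in> \<T>" and GX: "GX \<in> \<G>" and s: "s \<in> hom C SX X" and g: "g \<in> hom C X GX"
    and coker: "is_precokernel C (zero_objs C) s g"
    using sX \<open>\<S> \<subseteq> \<T>\<close> unfolding torsion_sequence_def short_exact_def short_preexact_def by auto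
  have "trivial_arr C (zero_objs C) (f \<cdot> s)"
    using torsion_theory_zero[OF tt SX FX compose_in_hom[OF s f]] .
  then obtain p where p: "p \<in> hom C GX FX" and pg: "p \<cdot> g = f"
    using coker is_precokernel_hom[OF s g] f hom_objs(2)[OF f] by blast
  have "\<exists>!l. l \<in> hom C W TX \<and> t \<cdot> l = x"
    if x: "x \<in> hom C W X" and triv: "trivial_arr C (\<T> \<inter> \<G>) (g \<cdot> x)" for W x
  proof -
    obtain Z u v where Z: "Z \<in> \<T>" and u: "u \<in> hom C W Z" and v: "v \<in> hom C Z GX"
      and gx: "g \<cdot> x = v \<cdot> u"
      using triv unfolding trivial_arr_hom[OF compose_in_hom[OF x g]] by blast
    have "trivial_arr C (zero_objs C) ((p \<cdot> v) \<cdot> u)"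
      using trivial_arr_compose_right[OF u compose_in_hom[OF v p]]
        torsion_theory_zero[OF tt Z FX compose_in_hom[OF v p]] by blast
    moreover have "(p \<cdot> v) \<cdot> u = f \<cdot> x"
      using compose_assoc[OF u v p] compose_assoc[OF x g p] gx pg by simp
    ultimately show ?thesis
      using ker is_prekernel_hom[OF f t] x hom_objs(1)[OF x] by simp
  qed
  moreover have "trivial_arr C (\<T> \<inter> \<G>) (g \<cdot> t)"
    using torsion_to_torsion_free_trivial[OF tt ss TX GX compose_in_hom[OF t g]] .
  ultimately show ?thesis
    using is_prekernel_hom[OF g t] by blast
qed

text \<open>Dually, the object through which \<open>y t\<close> factors is in \<open>\<G>\<close>, and \<open>s\<close> factors through \<open>t\<close>; so
  whenever \<open>y t\<close> is trivial, \<open>y s\<close> factors through a morphism from \<open>\<S>\<close> to \<open>\<G>\<close> and is zero.\<close>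

lemma torsion_free_part_precokernel:
  assumes tt: "torsion_theory C \<T> \<F>" and ss: "torsion_theory C \<S> \<G>" and "\<S> \<subseteq> \<T>"
    and tX: "torsion_sequence C \<T> \<F> X TX t f FX"
    and sX: "torsion_sequence C \<S> \<G> X SX s g GX"
  shows "is_precokernel C (\<T> \<inter> \<G>) t g"
proof -
  have TX: "TX \<in> \<T>" and FX: "FX \<in> \<F>" and t: "t \<in> hom C TX X" and f: "f \<in> hom C X FX"
    and ker: "is_prekernel C (zero_objs C) f t"
    using tX unfolding torsion_sequence_def short_exact_def short_preexact_def by auto
  have SX: "SX \<in> \<S>" and GX: "GX \<in> \<G>" and s: "s \<in> hom C SX X" and g: "g \<in> hom C X GX"
    and coker: "is_precokernel C (zero_objs C) s g"
    using sX unfolding torsion_sequence_def short_exact_def short_preexact_def by auto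
  have "trivial_arr C (zero_objs C) (f \<cdot> s)"
    using torsion_theory_zero[OF tt _ FX compose_in_hom[OF s f]] SX \<open>\<S> \<subseteq> \<T>\<close> by blast
  then obtain i where i: "i \<in> hom C SX TX" and ti: "t \<cdot> i = s"
    using ker is_prekernel_hom[OF f t] s hom_objs(1)[OF s] by blast
  have "\<exists>!l. l \<in> hom C GX W \<and> l \<cdot> g = y"
    if y: "y \<in> hom C X W" and triv: "trivial_arr C (\<T> \<inter> \<G>) (y \<cdot> t)" for W y
  proof -
    obtain Z u v where Z: "Z \<in> \<G>" and u: "u \<in> hom C TX Z" and v: "v \<in> hom C Z W"
      and yt: "y \<cdot> t = v \<cdot> u"
      using triv unfolding trivial_arr_hom[OF compose_in_hom[OF t y]] by blast
    have "trivial_arr C (zero_objs C) (v \<cdot> (u \<cdot> i))"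
      using trivial_arr_compose_left[OF compose_in_hom[OF i u] v]
        torsion_theory_zero[OF ss SX Z compose_in_hom[OF i u]] by blast
    moreover have "v \<cdot> (u \<cdot> i) = y \<cdot> s"
      using compose_assoc[OF i u v] compose_assoc[OF i t y] yt ti by simp
    ultimately show ?thesis
      using coker is_precokernel_hom[OF s g] y hom_objs(2)[OF y] by simp
  qed
  moreover have "trivial_arr C (\<T> \<inter> \<G>) (g \<cdot> t)"
    using torsion_to_torsion_free_trivial[OF tt ss TX GX compose_in_hom[OF t g]] .
  ultimately show ?thesis
    using is_precokernel_hom[OF t g] by blast
qed

end

theorem theorem4p2:
  fixes C :: "('o, 'm) cat"
    and \<T> \<F> \<S> \<G> :: "'o set"
  assumes "semi_abelian C"
    and "torsion_theory C \<T> \<F>"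
    and "torsion_theory C \<S> \<G>"
    and "\<S> \<subseteq> \<T>"
  shows "pretorsion_theory C (\<T> \<inter> \<G>) \<T> \<G> \<and>
    (\<forall>X \<in> objs C. \<forall>TX t f FX SX s g GX.
       torsion_sequence C \<T> \<F> X TX t f FX \<longrightarrow>
       torsion_sequence C \<S> \<G> X SX s g GX \<longrightarrow>
       pretorsion_sequence C (\<T> \<inter> \<G>) \<T> \<G> X TX t g GX)"
proof -
  interpret category C
    using assms(1) unfolding semi_abelian_def by blast
  have seq: "pretorsion_sequence C (\<T> \<inter> \<G>) \<T> \<G> X TX t g GX"
    if tX: "torsion_sequence C \<T> \<F> X TX t f FX" and sX: "torsion_sequence C \<S> \<G> X SX s g GX"
    for X TX t f FX SX s g GX
    using torsion_part_prekernel[OF assms(2-4) tX sX]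
      torsion_free_part_precokernel[OF assms(2-4) tX sX] tX sX
    unfolding pretorsion_sequence_def short_preexact_def torsion_sequence_def by blast
  have "\<exists>A t f B. pretorsion_sequence C (\<T> \<inter> \<G>) \<T> \<G> X A t f B" if X: "X \<in> objs C" for X
  proof -
    obtain TX t f FX where "torsion_sequence C \<T> \<F> X TX t f FX"
      using assms(2) X unfolding torsion_theory_def by blast
    moreover obtain SX s g GX where "torsion_sequence C \<S> \<G> X SX s g GX"
      using assms(3) X unfolding torsion_theory_def by blast
    ultimately show ?thesis
      using seq by blast
  qed
  moreover have "full_subcategory C \<T>" and "full_subcategory C \<G>"
    using assms(2,3) unfolding torsion_theory_def by auto
  ultimately have "pretorsion_theory C (\<T> \<inter> \<G>) \<T> \<G>"
    using torsion_to_torsion_free_trivial[OF assms(2,3)] unfolding pretorsion_theory_def by blast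
  then show ?thesis
    using seq by blast
qed

end
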